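(* Let $\tilde\eta,\tilde\nu,\tilde\tau$ be non-negative functions, analytic in a neighborhood of $0$, with Taylor coefficients $\eta_i,\nu_i,\tau_i$ as in Assumption A of the context, and suppose $0<\nu_0=\tau_0$ and $\eta_0\ge\tau_0^2/2$. Consider algorithm $(\mathcal A)$ (defined in the context) with $\eta=\tilde\eta(\sqrt q)$, $\nu=\tilde\nu(\sqrt q)$, $\tau=\tilde\tau(\sqrt q)$, where $q=\mu s$. (i) Suppose that (ia) $\eta_0=\tau_0^2/2$, $\nu_1-\tau_1<\tau_0\left(\frac{\tau_0}{2}-1\right)$, and $2\eta_1<\nu_1\tau_1+\frac{\tau_0^2}{2}\left(\frac52\tau_0-2\right)$. Then there exist constants $C,C_0,C_1>0$, depending only on $(\tilde\eta,\tilde\nu,\tilde\tau)$, such that for all $0<\mu\le L$, all $f\in\mathcal S^1_{\mu,L}$, all $x_0\in\mathbb R^n$, all $0<s\le C_0\,\mu/L^2$ and all $k\ge1$, the iterates of $(\mathcal A)$ satisfy $$f(x_k)-f^*\le C\,L\,\|x_0-x^*\|^2(1-C_1\sqrt{\mu s})^k.\qquad(1)$$ (ii) Suppose that one of the following conditions holds: (iia) $\eta_0=\tau_0^2/2$, $\nu_1-\tau_1<\tau_0\left(\frac{\tau_0}{2}-1\right)$, and $2\eta_1\ge\nu_1\tau_1+\frac{\tau_0^2}{2}\left(\frac52\tau_0-2\right)$; (iib) $\eta_0>\tau_0^2/2$ and $\nu_1-\tau_1<(\tau_0-1)\tau_0-\eta_0$; (iic) $\eta_0>\tau_0^2/2$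 and $(\tau_0-1)\tau_0-\eta_0<\nu_1-\tau_1<\eta_0-\tau_0$. Then there exist constants $C,C_0,C_1>0$, depending only on $(\tilde\eta,\tilde\nu,\tilde\tau)$, such that for all $0<\mu\le L$, all $f\in\mathcal S^1_{\mu,L}$, all $x_0\in\mathbb R^n$, all $0<s\le C_0/L$ and all $k\ge1$, the iterates of $(\mathcal A)$ satisfy (1).
   Context: For $0<\mu\le L$, $\mathcal S^1_{\mu,L}$ is the set of continuously differentiable convex functions $f:\mathbb R^n\to\mathbb R$ that are $L$-smooth ($\|\nabla f(y)-\nabla f(x)\|\le L\|y-x\|$ for all $x,y$) and $\mu$-strongly convex ($f(y)\ge f(x)+\langle\nabla f(x),y-x\rangle+\frac{\mu}{2}\|y-x\|^2$ for all $x,y$); $\|\cdot\|$ is the Euclidean norm. $x^*$ is the unique minimizer of $f$ and $f^*=f(x^* )$. For a stepsize $s>0$ put $q=\mu s$. Algorithm $(\mathcal A)$ with parameters $\eta,\nu,\tau\ge0$: starting from $x_0=z_0\in\mathbb R^n$, for $k\ge0$, $$y_{k+1}=x_k-\eta s\nabla f(x_k),$$ $$z_{k+1}=\nu\sqrt q\,\Big(x_k-\frac1\mu\nabla f(x_k)\Big)+(1-\nu\sqrt q)z_k,$$ $$x_{k+1}=\frac{\tau\sqrt q}{1+\sqrt q}z_{k+1}+\Big(1-\frac{\tau\sqrt q}{1+\sqrt q}\Big)y_{k+1}.$$ Assumption A: there are non-negative functions $\tilde\eta,\tilde\nu,\tilde\tau$, analytic in a neighborhood of $0$, such that $\eta=\tilde\eta(\sqrt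 q)$, $\nu=\tilde\nu(\sqrt q)$, $\tau=\tilde\tau(\sqrt q)$; thus $\eta=\sum_{i\ge0}\eta_i(\sqrt q)^i$, $\nu=\sum_{i\ge0}\nu_i(\sqrt q)^i$, $\tau=\sum_{i\ge0}\tau_i(\sqrt q)^i$ are convergent expansions for $0\le q\le q_0$, for some constant $q_0>0$. *)

theory Defs
  imports "HOL-Analysis.Analysis"
begin

text \<open>
  The dimension of the ambient space has to be quantified inside formulas (the constants
  must not depend on it), so it cannot be a type parameter.  All spaces \<open>\<real>\<^sup>n\<close> are
  therefore realised inside one type: finitely supported real sequences with the Euclidean inner
  product, \<open>Rn n\<close> being the sequences that vanish from index \<open>n\<close> on.
\<close>

typedef fvec = "{x :: nat \<Rightarrow> real. finite {i. x i \<noteq> 0}}"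
  morphisms coord Abs_fvec
  by (rule exI[of _ "\<lambda>_. 0"]) simp

lemma finite_coord: "finite {i. coord x i \<noteq> 0}"
  using coord[of x] by simp

lemma coord_Abs_fvec: "finite {i. g i \<noteq> 0} \<Longrightarrow> coord (Abs_fvec g) = g"
  by (simp add: Abs_fvec_inverse)

lemma fvec_eq_iff: "x = y \<longleftrightarrow> (\<forall>i. coord x i = coord y i)"
  by (auto simp: coord_inject[symmetric])

instantiation fvec :: real_vector
begin

definition "0 = Abs_fvec (\<lambda>i. 0)"
definition "x + y = Abs_fvec (\<lambda>i. coord x i + coord y i)"
definition "x - y = Abs_fvec (\<lambda>i. coord x i - coord y i)"
definition "- x = Abs_fvec (\<lambda>i. - coord x i)"
definition "r *\<^sub>R x = Abs_fvec (\<lambda>i. r * coord x i)"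

lemma coord_zero [simp]: "coord 0 i = 0"
  by (simp add: zero_fvec_def coord_Abs_fvec)

lemma coord_add [simp]: "coord (x + y) i = coord x i + coord y i"
proof -
  have "finite {i. coord x i + coord y i \<noteq> 0}"
    by (rule finite_subset[OF _ finite_UnI[OF finite_coord[of x] finite_coord[of y]]]) auto
  then show ?thesis by (simp add: plus_fvec_def coord_Abs_fvec)
qed

lemma coord_diff [simp]: "coord (x - y) i = coord x i - coord y i"
proof -
  have "finite {i. coord x i - coord y i \<noteq> 0}"
    by (rule finite_subset[OF _ finite_UnI[OF finite_coord[of x] finite_coord[of y]]]) auto
  then show ?thesis by (simp add: minus_fvec_def coord_Abs_fvec)
qed

lemma coord_uminus [simp]: "coord (- x) i = - coord x i"
  using finite_coord[of x] by (simp add: uminus_fvec_def coord_Abs_fvec)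

lemma coord_scaleR [simp]: "coord (r *\<^sub>R x) i = r * coord x i"
proof -
  have "finite {i. r * coord x i \<noteq> 0}"
    by (rule finite_subset[OF _ finite_coord[of x]]) auto
  then show ?thesis by (simp add: scaleR_fvec_def coord_Abs_fvec)
qed

instance
  by standard (simp_all add: fvec_eq_iff algebra_simps)

end

instantiation fvec :: real_inner
begin

definition "inner x y = (\<Sum>i | coord x i * coord y i \<noteq> 0. coord x i * coord y i)"
definition "norm (x :: fvec) = sqrt (inner x x)"
definition "sgn (x :: fvec) = x /\<^sub>R norm x"
definition "dist (x :: fvec) y = norm (x - y)"
definition "uniformity = (INF e\<in>{0<..}. principal {(x :: fvec, y). dist x y < e})"
definition "open (U :: fvec set) \<longleftrightarrow>
  (\<forall>x\<in>U. eventually (\<lambda>(x', y). x' = x \<longrightarrow> y \<in> U) uniformity)"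

lemma inner_fvec_eq_sum:
  assumes "finite A" "{i. coord x i \<noteq> 0} \<subseteq> A \<or> {i. coord y i \<noteq> 0} \<subseteq> A"
  shows "inner x y = (\<Sum>i\<in>A. coord x i * coord y i)"
  unfolding inner_fvec_def
  by (rule sum.mono_neutral_left) (use assms in auto)

instance
proof
  fix x y z :: fvec and r :: real
  show "inner x y = inner y x"
    by (simp add: inner_fvec_def mult.commute)
  show "inner (x + y) z = inner x z + inner y z"
    by (simp add: inner_fvec_eq_sum[OF finite_coord[of z]] distrib_right sum.distrib)
  show "inner (r *\<^sub>R x) y = r * inner x y"
    by (simp add: inner_fvec_eq_sum[OF finite_coord[of y]] sum_distrib_left mult.assoc)
  show "0 \<le> inner x x"
    by (simp add: inner_fvec_def sum_nonneg)
  show "inner x x = 0 \<longleftrightarrow> x = 0"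
    by (auto simp: inner_fvec_eq_sum[OF finite_coord[of x]] sum_nonneg_eq_0_iff finite_coord
        fvec_eq_iff)
qed (simp_all add: norm_fvec_def sgn_fvec_def dist_fvec_def uniformity_fvec_def open_fvec_def)

end

definition Rn :: "nat \<Rightarrow> fvec set" where
  "Rn n = {x. \<forall>i\<ge>n. coord x i = 0}"

lemma inner_Rn:
  assumes "x \<in> Rn n"
  shows "inner x y = (\<Sum>i<n. coord x i * coord y i)"
  by (rule inner_fvec_eq_sum) (use assms in \<open>auto simp: Rn_def not_le[symmetric]\<close>)

definition grad :: "nat \<Rightarrow> (fvec \<Rightarrow> real) \<Rightarrow> fvec \<Rightarrow> fvec" where
  "grad n f x = (THE g. g \<in> Rn n \<and> (f has_derivative (\<lambda>h. inner g h)) (at x within Rn n))"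

lemma subspace_Rn: "subspace (Rn n)"
  by (auto simp: subspace_def Rn_def)

definition fbasis :: "nat \<Rightarrow> fvec" where
  "fbasis j = Abs_fvec (\<lambda>i. if i = j then 1 else 0)"

lemma coord_fbasis [simp]: "coord (fbasis j) i = (if i = j then 1 else 0)"
  by (simp add: fbasis_def coord_Abs_fvec)

lemma coord_sum: "coord (\<Sum>j\<in>A. g j) i = (\<Sum>j\<in>A. coord (g j) i)"
  by (induction A rule: infinite_finite_induct) auto

lemma Rn_expand:
  assumes "x \<in> Rn n"
  shows "x = (\<Sum>j<n. coord x j *\<^sub>R fbasis j)"
  using assms by (auto simp: fvec_eq_iff coord_sum Rn_def if_distrib sum.delta cong: if_cong)

lemma grad_unique:
  assumes "x \<in> Rn n" "g \<in> Rn n" "g' \<in> Rn n"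
    and "(f has_derivative (\<lambda>h. inner g h)) (at x within Rn n)"
    and "(f has_derivative (\<lambda>h. inner g' h)) (at x within Rn n)"
  shows "g = g'"
proof -
  define d where "d = g - g'"
  have line: "((\<lambda>t::real. x + t *\<^sub>R d) has_derivative (\<lambda>t. t *\<^sub>R d)) (at 0 within UNIV)"
    by (auto intro!: derivative_eq_intros)
  have d: "d \<in> Rn n"
    using subspace_diff[OF subspace_Rn] assms unfolding d_def by blast
  have sub: "(\<lambda>t::real. x + t *\<^sub>R d) ` UNIV \<subseteq> Rn n"
    using assms(1) d subspace_Rn[of n] by (auto simp: subspace_def)
  have *: "((\<lambda>t::real. f (x + t *\<^sub>R d)) has_derivative (\<lambda>t. inner u (t *\<^sub>R d))) (at 0)"
    if "(f has_derivative (\<lambda>h. inner u h)) (at x within Rn n)" for u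
  proof -
    have "(f has_derivative (\<lambda>h. inner u h)) (at (x + 0 *\<^sub>R d) within range (\<lambda>t::real. x + t *\<^sub>R d))"
      using has_derivative_subset[OF that sub] by simp
    from has_derivative_in_compose[OF line this] show ?thesis by simp
  qed
  have "(\<lambda>t::real. inner g (t *\<^sub>R d)) = (\<lambda>t. inner g' (t *\<^sub>R d))"
    using has_derivative_unique[OF *[OF assms(4)] *[OF assms(5)]] .
  then have "inner g d = inner g' d"
    by (metis scaleR_one)
  then have "inner d d = 0"
    by (simp add: d_def inner_diff_left inner_diff_right)
  then show ?thesis
    by (simp add: d_def)
qed

lemma grad_has_derivative:
  assumes "f differentiable_on Rn n" "x \<in> Rn n"
  shows "grad n f x \<in> Rn n \<and>
    (f has_derivative (\<lambda>h. inner (grad n f x) h)) (at x within Rn n)"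
proof -
  obtain D where D: "(f has_derivative D) (at x within Rn n)"
    using assms unfolding differentiable_on_def differentiable_def by blast
  define g where "g = (\<Sum>j<n. D (fbasis j) *\<^sub>R fbasis j)"
  have cg: "coord g i = (if i < n then D (fbasis i) else 0)" for i
    by (simp add: g_def coord_sum if_distrib cong: if_cong)
  then have g: "g \<in> Rn n"
    by (simp add: Rn_def)
  have lin: "linear D"
    using D has_derivative_linear by blast
  have eq: "D h = inner g h" if "h \<in> Rn n" for h
  proof -
    have "D h = D (\<Sum>j<n. coord h j *\<^sub>R fbasis j)"
      using Rn_expand[OF that] by simp
    also have "\<dots> = (\<Sum>j<n. coord h j * D (fbasis j))"
      by (simp add: linear_sum[OF lin] linear_scale[OF lin])
    also have "\<dots> = inner g h"
      unfolding inner_Rn[OF g] by (rule sum.cong) (auto simp: cg)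
    finally show ?thesis .
  qed
  have "(f has_derivative (\<lambda>h. inner g h)) (at x within Rn n)"
    unfolding has_derivative_within
  proof
    show "bounded_linear (\<lambda>h. inner g h)"
      by (rule bounded_linear_inner_right)
    have "((\<lambda>y. (1 / norm (y - x)) *\<^sub>R (f y - (f x + D (y - x)))) \<longlongrightarrow> 0) (at x within Rn n)"
      using D unfolding has_derivative_within by blast
    then show "((\<lambda>y. (1 / norm (y - x)) *\<^sub>R (f y - (f x + inner g (y - x)))) \<longlongrightarrow> 0)
        (at x within Rn n)"
    proof (rule Lim_transform_eventually)
      show "\<forall>\<^sub>F y in at x within Rn n. (1 / norm (y - x)) *\<^sub>R (f y - (f x + D (y - x))) =
          (1 / norm (y - x)) *\<^sub>R (f y - (f x + inner g (y - x)))"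
        using eq subspace_diff[OF subspace_Rn _ assms(2)]
        by (auto simp: eventually_at_filter)
    qed
  qed
  with g have "\<exists>!g. g \<in> Rn n \<and> (f has_derivative (\<lambda>h. inner g h)) (at x within Rn n)"
    using grad_unique[OF assms(2)] by blast
  then show ?thesis
    unfolding grad_def by (rule theI')
qed

text \<open>The class \<open>S\<^sup>1\<close> with parameters \<open>\<mu>\<close>, \<open>L\<close> on \<open>\<real>\<^sup>n\<close>; only the values of \<open>f\<close> on \<open>Rn n\<close> matter.\<close>

definition smooth_strongly_convex :: "nat \<Rightarrow> real \<Rightarrow> real \<Rightarrow> (fvec \<Rightarrow> real) set" where
  "smooth_strongly_convex n \<mu> L = {f.
     f differentiable_on Rn n \<and> continuous_on (Rn n) (grad n f) \<and>
     convex_on (Rn n) f \<and>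
     (\<forall>x\<in>Rn n. \<forall>y\<in>Rn n. norm (grad n f y - grad n f x) \<le> L * norm (y - x)) \<and>
     (\<forall>x\<in>Rn n. \<forall>y\<in>Rn n.
        f y \<ge> f x + inner (grad n f x) (y - x) + \<mu> / 2 * (norm (y - x))\<^sup>2)}"

text \<open>The value \<open>y 0\<close> is not used by the algorithm and is left unconstrained.\<close>

definition algorithm_A ::
  "(fvec \<Rightarrow> fvec) \<Rightarrow> real \<Rightarrow> real \<Rightarrow> real \<Rightarrow> real \<Rightarrow> real \<Rightarrow> fvec \<Rightarrow>
   (nat \<Rightarrow> fvec) \<Rightarrow> (nat \<Rightarrow> fvec) \<Rightarrow> (nat \<Rightarrow> fvec) \<Rightarrow> bool" where
  "algorithm_A G \<mu> s \<eta> \<nu> \<tau> x0 x y z \<longleftrightarrow>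
     (let q = \<mu> * s in
      x 0 = x0 \<and> z 0 = x0 \<and>
      (\<forall>k. y (Suc k) = x k - (\<eta> * s) *\<^sub>R G (x k) \<and>
           z (Suc k) = (\<nu> * sqrt q) *\<^sub>R (x k - (1 / \<mu>) *\<^sub>R G (x k)) + (1 - \<nu> * sqrt q) *\<^sub>R z k \<and>
           x (Suc k) = (\<tau> * sqrt q / (1 + sqrt q)) *\<^sub>R z (Suc k)
                     + (1 - \<tau> * sqrt q / (1 + sqrt q)) *\<^sub>R y (Suc k)))"

text \<open>
  The linear rate with constants \<open>C\<close>, \<open>C1\<close>, uniformly over all dimensions, all problem data
  and all stepsizes \<open>s \<le> smax \<mu> L\<close>.  The functions \<open>e\<close>, \<open>v\<close>, \<open>t\<close> give the parameters
  \<open>\<eta>\<close>, \<open>\<nu>\<close>, \<open>\<tau>\<close> in terms of \<open>sqrt q\<close>; \<open>xs\<close> is the minimizer.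
\<close>

definition linear_rate ::
  "(real \<Rightarrow> real) \<Rightarrow> (real \<Rightarrow> real) \<Rightarrow> (real \<Rightarrow> real) \<Rightarrow> (real \<Rightarrow> real \<Rightarrow> real) \<Rightarrow>
   real \<Rightarrow> real \<Rightarrow> bool" where
  "linear_rate e v t smax C C1 \<longleftrightarrow>
     (\<forall>n \<mu> L f xs x0 s x y z k.
        0 < \<mu> \<and> \<mu> \<le> L \<and> f \<in> smooth_strongly_convex n \<mu> L \<and>
        is_arg_min f (\<lambda>u. u \<in> Rn n) xs \<and> x0 \<in> Rn n \<and>
        0 < s \<and> s \<le> smax \<mu> L \<and>
        algorithm_A (grad n f) \<mu> s (e (sqrt (\<mu> * s))) (v (sqrt (\<mu> * s))) (t (sqrt (\<mu> * s)))
          x0 x y z \<and>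
        k \<ge> 1 \<longrightarrow>
        f (x k) - f xs \<le> C * L * (norm (x0 - xs))\<^sup>2 * (1 - C1 * sqrt (\<mu> * s)) ^ k)"

end

theory Submission
  imports Defs
begin

text \<open>
  One Lyapunov function serves all cases: with \<open>g\<^sub>k = \<nabla>f(x\<^sub>k)\<close>,
  \<open>E\<^sub>k = f(x\<^sub>k) - f\<^sup>* - (\<eta>s/2) |g\<^sub>k|\<^sup>2 + (\<mu>/2) |z\<^sub>k\<^sub>+\<^sub>1 - x\<^sup>*|\<^sup>2\<close>.
  Pairing \<open>x\<^sub>k\<close> with \<open>z\<^sub>k\<^sub>+\<^sub>1\<close> makes both increments involve the same gradient, and co-coercivity
  turns \<open>\<langle>g\<^sub>k, g\<^sub>k\<^sub>+\<^sub>1\<rangle>\<close> into a telescoping pair of squares.  With \<open>r = sqrt (\<mu>s)\<close>, the increment of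
  \<open>E\<close> is then at most \<open>-\<nu>r (f - f\<^sup>* + \<mu>/2 |z - x\<^sup>*|\<^sup>2 + (1 - \<nu>r) \<mu>/2 |z - x|\<^sup>2)\<close> plus errors of order
  \<open>r\<^sup>2 \<langle>g, z - x\<rangle>\<close> (since \<open>\<nu>\<^sub>0 = \<tau>\<^sub>0\<close>) and \<open>(\<nu>\<^sup>2/2 - \<eta>) s |g|\<^sup>2\<close>, whose coefficient is at most
  \<open>O(r)\<close> (since \<open>\<eta>\<^sub>0 \<ge> \<tau>\<^sub>0\<^sup>2/2\<close>).  As \<open>s |g|\<^sup>2 \<le> 2 L s (f - f\<^sup>*)\<close>, both errors are absorbed as soon as
  \<open>L s\<close> is small.
\<close>

section \<open>Smooth convex functions on a subspace\<close>

lemma has_derivative_along_line: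
  fixes f :: "'a::real_normed_vector \<Rightarrow> 'b::real_normed_vector"
  assumes "(f has_derivative D) (at (x + t *\<^sub>R d) within S)"
    and "\<And>u. u \<in> T \<Longrightarrow> x + u *\<^sub>R d \<in> S"
  shows "((\<lambda>t. f (x + t *\<^sub>R d)) has_derivative (\<lambda>k. D (k *\<^sub>R d))) (at t within T)"
proof (rule has_derivative_in_compose[where f = "\<lambda>t. x + t *\<^sub>R d"])
  show "((\<lambda>t. x + t *\<^sub>R d) has_derivative (\<lambda>k. k *\<^sub>R d)) (at t within T)"
    by (auto intro!: derivative_eq_intros)
  show "(f has_derivative D) (at (x + t *\<^sub>R d) within (\<lambda>t. x + t *\<^sub>R d) ` T)"
    using assms by (blast intro: has_derivative_subset)
qed

lemma descent_lemma:
  fixes f :: "'a::real_inner \<Rightarrow> real"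
  assumes "convex S" and x: "x \<in> S" and y: "y \<in> S"
    and gradient: "\<And>u. u \<in> S \<Longrightarrow> (f has_derivative (\<lambda>h. inner (G u) h)) (at u within S)"
    and lipschitz: "L-lipschitz_on S G"
  shows "f y \<le> f x + inner (G x) (y - x) + L / 2 * (norm (y - x))\<^sup>2"
proof -
  define d where "d = y - x"
  define p where "p t = x + t *\<^sub>R d" for t :: real
  define h where "h t = f (p t) - t * inner (G x) d - L / 2 * t\<^sup>2 * (norm d)\<^sup>2" for t
  have p_mem: "p t \<in> S" if "t \<in> {0..1}" for t
    using convexD_alt[OF \<open>convex S\<close> x y, of t] that by (simp add: p_def d_def algebra_simps)
  have "(h has_derivative (\<lambda>k. (inner (G (p t) - G x) d - L * t * (norm d)\<^sup>2) * k))
      (at t within {0..1})" if t: "t \<in> {0..1}" for t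
  proof -
    have "((\<lambda>t. f (p t)) has_derivative (\<lambda>k. inner (G (p t)) (k *\<^sub>R d))) (at t within {0..1})"
      using gradient[OF p_mem[OF t]] p_mem unfolding p_def by (rule has_derivative_along_line)
    then show ?thesis
      unfolding h_def
      by (auto intro!: derivative_eq_intros simp: algebra_simps inner_simps power2_eq_square)
  qed
  then obtain t where t: "t \<in> {0..1}"
    and mvt: "h 1 - h 0 = inner (G (p t) - G x) d - L * t * (norm d)\<^sup>2"
    using mvt_very_simple[of 0 1 h
        "\<lambda>t k. (inner (G (p t) - G x) d - L * t * (norm d)\<^sup>2) * k"] by auto
  have "inner (G (p t) - G x) d \<le> norm (G (p t) - G x) * norm d"
    by (rule norm_cauchy_schwarz)
  also have "\<dots> \<le> L * norm (p t - x) * norm d"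
    using lipschitz_onD[OF lipschitz p_mem[OF t] x]
    by (intro mult_right_mono) (auto simp: dist_norm)
  also have "\<dots> = L * t * (norm d)\<^sup>2"
    using t by (simp add: p_def power2_eq_square)
  finally have "h 1 \<le> h 0"
    using mvt by simp
  then show ?thesis
    by (simp add: h_def p_def d_def)
qed

locale smooth_convex_on =
  fixes S :: "'a::real_inner set" and f :: "'a \<Rightarrow> real" and G :: "'a \<Rightarrow> 'a" and L :: real
  assumes subspace: "subspace S"
    and G_mem: "u \<in> S \<Longrightarrow> G u \<in> S"
    and gradient: "u \<in> S \<Longrightarrow> (f has_derivative (\<lambda>h. inner (G u) h)) (at u within S)"
    and lipschitz: "L-lipschitz_on S G"
    and above_tangent: "u \<in> S \<Longrightarrow> w \<in> S \<Longrightarrow> f u + inner (G u) (w - u) \<le> f w"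
    and L_pos: "0 < L"
begin

lemma smooth_upper_bound:
  assumes "u \<in> S" "w \<in> S"
  shows "f w \<le> f u + inner (G u) (w - u) + L / 2 * (norm (w - u))\<^sup>2"
  using subspace_imp_convex[OF subspace] assms gradient lipschitz by (rule descent_lemma)

lemma inverse_L_step_upper_bound:
  assumes "u \<in> S" "p \<in> S"
  shows "f (u - (1 / L) *\<^sub>R p) \<le> f u - inner (G u) p / L + (norm p)\<^sup>2 / (2 * L)"
proof -
  have "u - (1 / L) *\<^sub>R p \<in> S"
    using assms subspace by (simp add: subspace_diff subspace_scale)
  from smooth_upper_bound[OF assms(1) this] show ?thesis
    using L_pos by (simp add: power_divide power2_eq_square)
qed

lemma gradient_cocoercive:
  assumes "u \<in> S" "w \<in> S"
  shows "f w - f u \<le> inner (G w) (w - u) - (norm (G w - G u))\<^sup>2 / (2 * L)"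
proof -
  define p where "p = G u - G w"
  have p: "p \<in> S"
    unfolding p_def using assms G_mem subspace by (blast intro: subspace_diff)
  then have "u - (1 / L) *\<^sub>R p \<in> S"
    using assms subspace by (simp add: subspace_diff subspace_scale)
  then have "f w + inner (G w) (u - (1 / L) *\<^sub>R p - w) \<le> f (u - (1 / L) *\<^sub>R p)"
    by (rule above_tangent[OF assms(2)])
  also have "\<dots> \<le> f u - inner (G u) p / L + (norm p)\<^sup>2 / (2 * L)"
    by (rule inverse_L_step_upper_bound[OF assms(1) p])
  finally have "f w - f u \<le> inner (G w) (w - u) - inner p p / L + (norm p)\<^sup>2 / (2 * L)"
    by (simp add: p_def inner_simps diff_divide_distrib)
  also have "inner p p / L = 2 * ((norm p)\<^sup>2 / (2 * L))"
    by (simp add: power2_norm_eq_inner)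
  finally show ?thesis
    by (simp add: p_def norm_minus_commute)
qed

lemma gradient_at_minimizer:
  assumes "is_arg_min f (\<lambda>u. u \<in> S) xs"
  shows "G xs = 0"
proof -
  have xs: "xs \<in> S" and le: "\<And>u. u \<in> S \<Longrightarrow> f xs \<le> f u"
    using assms by (auto simp: is_arg_min_linorder)
  have "f xs \<le> f (xs - (1 / L) *\<^sub>R G xs)"
    using xs G_mem subspace by (intro le) (simp add: subspace_diff subspace_scale)
  also have "\<dots> \<le> f xs - inner (G xs) (G xs) / L + (norm (G xs))\<^sup>2 / (2 * L)"
    by (rule inverse_L_step_upper_bound[OF xs G_mem[OF xs]])
  finally have "(norm (G xs))\<^sup>2 \<le> 0"
    using L_pos by (simp add: dot_square_norm field_simps)
  then show ?thesis
    by simp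
qed

lemma gradient_square_le_gap:
  assumes "is_arg_min f (\<lambda>u. u \<in> S) xs" "u \<in> S"
  shows "(norm (G u))\<^sup>2 \<le> 2 * L * (f u - f xs)"
proof -
  have "f xs - f u \<le> - ((norm (G u))\<^sup>2 / (2 * L))"
    using gradient_cocoercive[OF assms(2), of xs] assms(1) gradient_at_minimizer[OF assms(1)]
    by (simp add: is_arg_min_linorder)
  then show ?thesis
    using L_pos by (simp add: field_simps)
qed

end

locale smooth_strongly_convex_on = smooth_convex_on +
  fixes \<mu> :: real
  assumes \<mu>_pos: "0 < \<mu>"
    and strongly_convex: "u \<in> S \<Longrightarrow> w \<in> S \<Longrightarrow>
      f u + inner (G u) (w - u) + \<mu> / 2 * (norm (w - u))\<^sup>2 \<le> f w"
begin

lemma quadratic_growth: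
  assumes "is_arg_min f (\<lambda>u. u \<in> S) xs" "u \<in> S"
  shows "\<mu> / 2 * (norm (u - xs))\<^sup>2 \<le> f u - f xs"
  using strongly_convex[of xs u] gradient_at_minimizer[OF assms(1)] assms
  by (simp add: is_arg_min_linorder)

lemma gap_plus_square_le_inner_gradient:
  assumes "xs \<in> S" "u \<in> S"
  shows "f u - f xs + \<mu> / 2 * (norm (u - xs))\<^sup>2 \<le> inner (G u) (u - xs)"
  using strongly_convex[OF assms(2,1)]
  by (simp add: inner_diff_right norm_minus_commute algebra_simps)

end

section \<open>The mirror step\<close>

lemma norm_diff_square_le:
  fixes a b :: "'a::real_inner"
  shows "(norm (a - b))\<^sup>2 \<le> 2 * ((norm a)\<^sup>2 + (norm b)\<^sup>2)"
proof -
  have "0 \<le> inner (a + b) (a + b)"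
    by simp
  then show ?thesis
    by (simp add: power2_norm_eq_inner inner_simps inner_commute)
qed

lemma norm_convex_combination_square:
  fixes a b :: "'a::real_inner"
  shows "(norm ((1 - c) *\<^sub>R a + c *\<^sub>R b))\<^sup>2
    = (1 - c) * (norm a)\<^sup>2 + c * (norm b)\<^sup>2 - c * (1 - c) * (norm (a - b))\<^sup>2"
  by (simp add: power2_norm_eq_inner inner_simps inner_commute algebra_simps)

lemma mirror_step_square_decrease:
  fixes X Z g :: "'a::real_inner"
  assumes "0 < \<mu>" "0 \<le> c"
    and gap: "F + \<mu> / 2 * (norm X)\<^sup>2 \<le> inner g X"
  shows "\<mu> / 2 * (norm ((1 - c) *\<^sub>R Z + c *\<^sub>R (X - (1 / \<mu>) *\<^sub>R g)))\<^sup>2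
    \<le> \<mu> / 2 * (norm Z)\<^sup>2 - c * (F + \<mu> / 2 * (norm Z)\<^sup>2 + (1 - c) * (\<mu> / 2 * (norm (Z - X))\<^sup>2))
      - (c - c\<^sup>2) * inner g (Z - X) + c\<^sup>2 / (2 * \<mu>) * (norm g)\<^sup>2"
proof -
  define Y where "Y = X - (1 / \<mu>) *\<^sub>R g"
  have square: "\<mu> / 2 * (norm (A + (1 / \<mu>) *\<^sub>R g))\<^sup>2
      = \<mu> / 2 * (norm A)\<^sup>2 + inner g A + (norm g)\<^sup>2 / (2 * \<mu>)" for A
    using \<open>0 < \<mu>\<close> by (simp add: power2_norm_eq_inner inner_simps inner_commute field_simps)
  have "\<mu> / 2 * (norm Y)\<^sup>2 = \<mu> / 2 * (norm X)\<^sup>2 - inner g X + (norm g)\<^sup>2 / (2 * \<mu>)"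
    using square[of "- X"] by (simp add: Y_def norm_minus_commute)
  also have "\<dots> \<le> - F + (norm g)\<^sup>2 / (2 * \<mu>)"
    using gap by simp
  finally have Y: "c * (\<mu> / 2 * (norm Y)\<^sup>2) \<le> c * (- F + (norm g)\<^sup>2 / (2 * \<mu>))"
    using \<open>0 \<le> c\<close> by (rule mult_left_mono)
  have ZY: "\<mu> / 2 * (norm (Z - Y))\<^sup>2
      = \<mu> / 2 * (norm (Z - X))\<^sup>2 + inner g (Z - X) + (norm g)\<^sup>2 / (2 * \<mu>)"
    using square[of "Z - X"] by (simp add: Y_def algebra_simps)
  have "\<mu> / 2 * (norm ((1 - c) *\<^sub>R Z + c *\<^sub>R Y))\<^sup>2 = (1 - c) * (\<mu> / 2 * (norm Z)\<^sup>2)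
      + c * (\<mu> / 2 * (norm Y)\<^sup>2) - c * (1 - c) * (\<mu> / 2 * (norm (Z - Y))\<^sup>2)"
    unfolding norm_convex_combination_square by (simp add: field_simps)
  also have "\<dots> \<le> (1 - c) * (\<mu> / 2 * (norm Z)\<^sup>2) + c * (- F + (norm g)\<^sup>2 / (2 * \<mu>))
      - c * (1 - c) * (\<mu> / 2 * (norm (Z - X))\<^sup>2 + inner g (Z - X) + (norm g)\<^sup>2 / (2 * \<mu>))"
    using Y unfolding ZY by simp
  also have "\<dots> = \<mu> / 2 * (norm Z)\<^sup>2
      - c * (F + \<mu> / 2 * (norm Z)\<^sup>2 + (1 - c) * (\<mu> / 2 * (norm (Z - X))\<^sup>2))
      - (c - c\<^sup>2) * inner g (Z - X) + c\<^sup>2 / (2 * \<mu>) * (norm g)\<^sup>2"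
    by (simp add: algebra_simps diff_divide_distrib power2_eq_square)
  finally show ?thesis
    unfolding Y_def .
qed

section \<open>Contraction of the Lyapunov function\<close>

text \<open>
  Here \<open>\<rho>\<close> is the factor in \<open>x\<^sub>k\<^sub>+\<^sub>1 - x\<^sub>k = \<rho> (z\<^sub>k\<^sub>+\<^sub>1 - x\<^sub>k\<^sub>+\<^sub>1) - \<eta> s g\<^sub>k\<close>, and \<open>h\<close> stands for \<open>L s\<close>.
\<close>

definition admissible_parameters :: "real \<Rightarrow> real \<Rightarrow> real \<Rightarrow> real \<Rightarrow> real \<Rightarrow> bool" where
  "admissible_parameters \<eta> \<nu> \<rho> r h \<longleftrightarrow>
    0 \<le> \<eta> \<and> 0 < \<nu> \<and> \<nu> * r \<le> 1 / 2 \<and> \<eta> * h \<le> 1 / 2 \<and> 2 * \<nu>\<^sup>2 * h \<le> 1 \<and>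
    (\<exists>K\<ge>0. \<bar>\<rho> - \<nu> * r + (\<nu> * r)\<^sup>2\<bar> \<le> K * r\<^sup>2 \<and> \<nu>\<^sup>2 / 2 - \<eta> \<le> K * r \<and> 4 * K * (K + \<nu>) * h \<le> \<nu>\<^sup>2)"

lemma relative_decrease_imp_contraction:
  fixes a b d :: real
  assumes "b \<le> a - d * b" "0 \<le> d" "d \<le> 1" "0 \<le> a"
  shows "b \<le> (1 - d / 2) * a"
proof -
  have "d * d \<le> d * 1"
    using assms by (intro mult_left_mono)
  then have one_le: "1 \<le> (1 + d) * (1 - d / 2)"
    by (simp add: algebra_simps)
  have "(1 + d) * b \<le> 1 * a"
    using assms by (simp add: algebra_simps)
  also have "\<dots> \<le> (1 + d) * (1 - d / 2) * a"
    using one_le \<open>0 \<le> a\<close> by (rule mult_right_mono)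
  finally have "(1 + d) * b \<le> (1 + d) * ((1 - d / 2) * a)"
    unfolding mult.assoc .
  then show ?thesis
    using assms by (simp add: mult_le_cancel_left)
qed

locale accelerated_iteration = smooth_strongly_convex_on S f G L \<mu>
  for S :: "'a::real_inner set" and f G L \<mu> +
  fixes xs :: 'a and x z :: "nat \<Rightarrow> 'a" and s r \<eta> \<nu> \<rho> :: real
  assumes minimizer: "is_arg_min f (\<lambda>u. u \<in> S) xs"
    and x_mem: "x k \<in> S"
    and s_pos: "0 < s" and r_pos: "0 < r" and r_square: "r\<^sup>2 = \<mu> * s"
    and z_0: "z 0 = x 0"
    and z_Suc: "z (Suc k) = (\<nu> * r) *\<^sub>R (x k - (1 / \<mu>) *\<^sub>R G (x k)) + (1 - \<nu> * r) *\<^sub>R z k"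
    and x_Suc: "x (Suc k) - x k = \<rho> *\<^sub>R (z (Suc k) - x (Suc k)) - (\<eta> * s) *\<^sub>R G (x k)"
    and admissible: "admissible_parameters \<eta> \<nu> \<rho> r (L * s)"
begin

lemma
  shows \<eta>_nonneg: "0 \<le> \<eta>" and \<nu>_pos: "0 < \<nu>" and \<nu>_r_le: "\<nu> * r \<le> 1 / 2"
    and \<eta>_le: "\<eta> * (L * s) \<le> 1 / 2" and \<nu>_square_le: "2 * \<nu>\<^sup>2 * (L * s) \<le> 1"
  using admissible unfolding admissible_parameters_def by auto

definition gap :: "nat \<Rightarrow> real" where
  "gap k = f (x k) - f xs"

definition energy :: "nat \<Rightarrow> real" where
  "energy k = gap k + \<mu> / 2 * (norm (z k - xs))\<^sup>2"

definition lyapunov :: "nat \<Rightarrow> real" where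
  "lyapunov k = gap k - \<eta> * s / 2 * (norm (G (x k)))\<^sup>2 + \<mu> / 2 * (norm (z (Suc k) - xs))\<^sup>2"

lemma gap_nonneg: "0 \<le> gap k"
  using minimizer x_mem by (simp add: gap_def is_arg_min_linorder)

lemma gap_le_energy: "gap k \<le> energy k"
  using \<mu>_pos by (simp add: energy_def)

lemma scaled_gradient_square_le_gap: "s * (norm (G (x k)))\<^sup>2 \<le> 2 * (L * s) * gap k"
  using mult_left_mono[OF gradient_square_le_gap[OF minimizer x_mem], of s] s_pos
  by (simp add: gap_def algebra_simps)

lemma gap_le_lyapunov: "gap k \<le> 2 * lyapunov k"
proof -
  have "\<eta> * (s * (norm (G (x k)))\<^sup>2) \<le> \<eta> * (2 * (L * s) * gap k)"
    using scaled_gradient_square_le_gap \<eta>_nonneg by (rule mult_left_mono)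
  also have "\<dots> = 2 * (\<eta> * (L * s)) * gap k"
    by simp
  also have "\<dots> \<le> 2 * (1 / 2) * gap k"
    using \<eta>_le gap_nonneg by (intro mult_right_mono mult_left_mono) auto
  finally have "gap k / 2 + \<mu> / 2 * (norm (z (Suc k) - xs))\<^sup>2 \<le> lyapunov k"
    by (simp add: lyapunov_def)
  moreover have "0 \<le> \<mu> / 2 * (norm (z (Suc k) - xs))\<^sup>2"
    using \<mu>_pos by simp
  ultimately show ?thesis
    by linarith
qed

lemma z_Suc_minus_minimizer:
  "z (Suc k) - xs
    = (1 - \<nu> * r) *\<^sub>R (z k - xs) + (\<nu> * r) *\<^sub>R ((x k - xs) - (1 / \<mu>) *\<^sub>R G (x k))"
  by (simp add: z_Suc algebra_simps)

lemma mirror_gradient_step_square_le_gap: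
  "\<mu> * (norm ((\<nu> * r / \<mu>) *\<^sub>R G (x k)))\<^sup>2 \<le> gap k"
proof -
  have "(norm ((\<nu> * r / \<mu>) *\<^sub>R G (x k)))\<^sup>2 = \<nu>\<^sup>2 * (\<mu> * s) / \<mu>\<^sup>2 * (norm (G (x k)))\<^sup>2"
    by (simp add: power_mult_distrib power_divide r_square)
  then have "\<mu> * (norm ((\<nu> * r / \<mu>) *\<^sub>R G (x k)))\<^sup>2 = \<nu>\<^sup>2 * (s * (norm (G (x k)))\<^sup>2)"
    using \<mu>_pos by (simp add: power2_eq_square)
  also have "\<dots> \<le> \<nu>\<^sup>2 * (2 * (L * s) * gap k)"
    using scaled_gradient_square_le_gap by (intro mult_left_mono) auto
  also have "\<dots> = 2 * \<nu>\<^sup>2 * (L * s) * gap k"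
    by simp
  also have "\<dots> \<le> 1 * gap k"
    using \<nu>_square_le gap_nonneg by (rule mult_right_mono)
  finally show ?thesis
    by simp
qed

lemma lyapunov_le_energy: "lyapunov k \<le> 4 * energy k"
proof -
  define c where "c = \<nu> * r"
  define g where "g = G (x k)"
  define M where "M = (1 - c) *\<^sub>R (z k - xs) + c *\<^sub>R (x k - xs)"
  have c: "0 \<le> c" "c \<le> 1"
    using \<nu>_pos r_pos \<nu>_r_le by (auto simp: c_def)
  have "(norm M)\<^sup>2 \<le> (1 - c) * (norm (z k - xs))\<^sup>2 + c * (norm (x k - xs))\<^sup>2"
    using c unfolding M_def norm_convex_combination_square by simp
  also have "\<dots> \<le> (norm (z k - xs))\<^sup>2 + (norm (x k - xs))\<^sup>2"
    using c by (intro add_mono mult_left_le_one_le) auto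
  finally have "\<mu> * (norm M)\<^sup>2 \<le> \<mu> * ((norm (z k - xs))\<^sup>2 + (norm (x k - xs))\<^sup>2)"
    using \<mu>_pos by (intro mult_left_mono) auto
  also have "\<dots> \<le> \<mu> * (norm (z k - xs))\<^sup>2 + 2 * gap k"
    using quadratic_growth[OF minimizer x_mem, of k] by (simp add: gap_def algebra_simps)
  finally have M: "\<mu> * (norm M)\<^sup>2 \<le> \<mu> * (norm (z k - xs))\<^sup>2 + 2 * gap k" .
  have "z (Suc k) - xs = M - (c / \<mu>) *\<^sub>R g"
    by (simp add: z_Suc_minus_minimizer M_def c_def g_def algebra_simps)
  then have "\<mu> / 2 * (norm (z (Suc k) - xs))\<^sup>2
      \<le> \<mu> / 2 * (2 * ((norm M)\<^sup>2 + (norm ((c / \<mu>) *\<^sub>R g))\<^sup>2))"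
    using \<mu>_pos norm_diff_square_le[of M "(c / \<mu>) *\<^sub>R g"]
    by (intro mult_left_mono) simp_all
  also have "\<dots> \<le> \<mu> * (norm (z k - xs))\<^sup>2 + 3 * gap k"
    using M mirror_gradient_step_square_le_gap[of k] by (simp add: c_def g_def algebra_simps)
  finally have "\<mu> / 2 * (norm (z (Suc k) - xs))\<^sup>2 \<le> \<mu> * (norm (z k - xs))\<^sup>2 + 3 * gap k" .
  moreover have "0 \<le> \<eta> * s / 2 * (norm (G (x k)))\<^sup>2" "0 \<le> \<mu> * (norm (z k - xs))\<^sup>2"
    using \<eta>_nonneg s_pos \<mu>_pos by simp_all
  ultimately show ?thesis
    by (simp add: lyapunov_def energy_def)
qed

lemma gap_increment:
  "gap (Suc k) - gap k \<le> \<rho> * inner (G (x (Suc k))) (z (Suc k) - x (Suc k))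
    - \<eta> * s / 2 * ((norm (G (x (Suc k))))\<^sup>2 + (norm (G (x k)))\<^sup>2)"
proof -
  define g g' where "g = G (x k)" and "g' = G (x (Suc k))"
  have "\<eta> * s / 2 * ((norm g')\<^sup>2 + (norm g)\<^sup>2)
      = \<eta> * s * inner g' g + \<eta> * s / 2 * (norm (g' - g))\<^sup>2"
    by (simp add: power2_norm_eq_inner inner_simps inner_commute algebra_simps)
  also have "\<eta> * s / 2 * (norm (g' - g))\<^sup>2 \<le> 1 / (2 * L) * (norm (g' - g))\<^sup>2"
    using \<eta>_le L_pos by (intro mult_right_mono) (auto simp: field_simps)
  finally have polarized: "\<eta> * s / 2 * ((norm g')\<^sup>2 + (norm g)\<^sup>2)
      \<le> \<eta> * s * inner g' g + (norm (g' - g))\<^sup>2 / (2 * L)"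
    by simp
  have "gap (Suc k) - gap k
      \<le> inner g' (x (Suc k) - x k) - (norm (g' - g))\<^sup>2 / (2 * L)"
    using gradient_cocoercive[OF x_mem x_mem] by (simp add: gap_def g_def g'_def)
  also have "inner g' (x (Suc k) - x k)
      = \<rho> * inner g' (z (Suc k) - x (Suc k)) - \<eta> * s * inner g' g"
    unfolding x_Suc by (simp add: g_def inner_diff_right)
  finally show ?thesis
    using polarized unfolding g_def g'_def by simp
qed

lemma lyapunov_increment:
  defines "g \<equiv> \<lambda>k. G (x k)"
  shows "lyapunov (Suc k) - lyapunov k
    \<le> - \<nu> * r * (energy (Suc k) + (1 - \<nu> * r) * (\<mu> / 2 * (norm (z (Suc k) - x (Suc k)))\<^sup>2))
      + (\<rho> - \<nu> * r + (\<nu> * r)\<^sup>2) * inner (g (Suc k)) (z (Suc k) - x (Suc k))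
      + (\<nu>\<^sup>2 / 2 - \<eta>) * (s * (norm (g (Suc k)))\<^sup>2)"
proof -
  have coeff: "(\<nu> * r)\<^sup>2 / (2 * \<mu>) * (norm (g j))\<^sup>2 = \<nu>\<^sup>2 / 2 * (s * (norm (g j))\<^sup>2)" for j
    using \<mu>_pos by (simp add: power_mult_distrib r_square)
  have "\<mu> / 2 * (norm (z (Suc j) - xs))\<^sup>2 \<le> \<mu> / 2 * (norm (z j - xs))\<^sup>2
      - \<nu> * r * (energy j + (1 - \<nu> * r) * (\<mu> / 2 * (norm (z j - x j))\<^sup>2))
      - (\<nu> * r - (\<nu> * r)\<^sup>2) * inner (g j) (z j - x j) + \<nu>\<^sup>2 / 2 * (s * (norm (g j))\<^sup>2)" for j
    using mirror_step_square_decrease[OF \<mu>_pos,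
        of "\<nu> * r" "gap j" "x j - xs" "g j" "z j - xs", unfolded coeff] \<nu>_pos r_pos
      gap_plus_square_le_inner_gradient[OF _ x_mem] minimizer
    by (simp add: z_Suc_minus_minimizer gap_def energy_def g_def is_arg_min_linorder)
  from this[of "Suc k"] show ?thesis
    using gap_increment[of k]
    by (simp add: lyapunov_def g_def algebra_simps diff_divide_distrib)
qed

lemma coupling_error_le:
  assumes "0 \<le> K" and "\<bar>\<epsilon>\<bar> \<le> K * r\<^sup>2"
  shows "\<epsilon> * inner g w \<le> \<nu> * r * (\<mu> / 4 * (norm w)\<^sup>2) + K\<^sup>2 / \<nu> * r * (s * (norm g)\<^sup>2)"
proof -
  define a b where "a = sqrt s * norm g" and "b = sqrt \<mu> * norm w"
  have sqrts: "r = sqrt \<mu> * sqrt s"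
    using r_square r_pos by (metis less_imp_le real_sqrt_mult real_sqrt_unique)
  have "\<epsilon> * inner g w \<le> \<bar>\<epsilon>\<bar> * \<bar>inner g w\<bar>"
    by (metis abs_ge_self abs_mult)
  also have "\<dots> \<le> K * r\<^sup>2 * (norm g * norm w)"
    using assms Cauchy_Schwarz_ineq2 by (intro mult_mono) auto
  also have "\<dots> = r * (K * (a * b))"
    by (simp add: power2_eq_square sqrts a_def b_def)
  also have "\<dots> \<le> r * (\<nu> / 4 * b\<^sup>2 + K\<^sup>2 / \<nu> * a\<^sup>2)"
  proof (rule mult_left_mono)
    have "0 \<le> (2 * K * a - \<nu> * b)\<^sup>2 / (4 * \<nu>)"
      using \<nu>_pos by simp
    also have "\<dots> = \<nu> / 4 * b\<^sup>2 + K\<^sup>2 / \<nu> * a\<^sup>2 - K * (a * b)"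
      using \<nu>_pos by (simp add: field_simps power2_eq_square)
    finally show "K * (a * b) \<le> \<nu> / 4 * b\<^sup>2 + K\<^sup>2 / \<nu> * a\<^sup>2"
      by simp
  qed (use r_pos in simp)
  also have "\<dots> = \<nu> * r * (\<mu> / 4 * (norm w)\<^sup>2) + K\<^sup>2 / \<nu> * r * (s * (norm g)\<^sup>2)"
    using \<mu>_pos s_pos by (simp add: a_def b_def power_mult_distrib algebra_simps)
  finally show ?thesis .
qed

lemma lyapunov_decrease: "lyapunov (Suc k) - lyapunov k \<le> - (\<nu> * r / 2) * energy (Suc k)"
proof -
  define w where "w = z (Suc k) - x (Suc k)"
  define Q where "Q = s * (norm (G (x (Suc k))))\<^sup>2"
  obtain K where "0 \<le> K" and coupling: "\<bar>\<rho> - \<nu> * r + (\<nu> * r)\<^sup>2\<bar> \<le> K * r\<^sup>2"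
    and gradient_excess: "\<nu>\<^sup>2 / 2 - \<eta> \<le> K * r" and small: "4 * K * (K + \<nu>) * (L * s) \<le> \<nu>\<^sup>2"
    using admissible unfolding admissible_parameters_def by blast
  have "0 \<le> Q"
    using s_pos by (simp add: Q_def)
  have "(K\<^sup>2 / \<nu> + K) * Q \<le> (K\<^sup>2 / \<nu> + K) * (2 * (L * s) * gap (Suc k))"
    unfolding Q_def using scaled_gradient_square_le_gap \<open>0 \<le> K\<close> \<nu>_pos
    by (intro mult_left_mono) auto
  also have "\<dots> = 4 * K * (K + \<nu>) * (L * s) * (gap (Suc k) / (2 * \<nu>))"
    using \<nu>_pos by (simp add: field_simps power2_eq_square)
  also have "\<dots> \<le> \<nu>\<^sup>2 * (gap (Suc k) / (2 * \<nu>))"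
    using small gap_nonneg \<nu>_pos by (intro mult_right_mono) auto
  also have "\<dots> = \<nu> / 2 * gap (Suc k)"
    using \<nu>_pos by (simp add: power2_eq_square)
  also have "\<dots> \<le> \<nu> / 2 * energy (Suc k)"
    using gap_le_energy \<nu>_pos by (intro mult_left_mono) auto
  finally have "r * ((K\<^sup>2 / \<nu> + K) * Q) \<le> r * (\<nu> / 2 * energy (Suc k))"
    using r_pos by (intro mult_left_mono) auto
  moreover have "\<nu> * r * (1 / 2 * (\<mu> / 2 * (norm w)\<^sup>2))
      \<le> \<nu> * r * ((1 - \<nu> * r) * (\<mu> / 2 * (norm w)\<^sup>2))"
    using \<nu>_r_le \<nu>_pos r_pos \<mu>_pos by (intro mult_left_mono mult_right_mono) auto
  moreover have "(\<nu>\<^sup>2 / 2 - \<eta>) * Q \<le> K * r * Q"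
    using gradient_excess \<open>0 \<le> Q\<close> by (rule mult_right_mono)
  moreover note coupling_error_le[OF \<open>0 \<le> K\<close> coupling, of "G (x (Suc k))" w]
  ultimately show ?thesis
    using lyapunov_increment[of k] unfolding w_def[symmetric] Q_def[symmetric]
    by (simp add: algebra_simps diff_divide_distrib)
qed

lemma lyapunov_contraction: "lyapunov (Suc k) \<le> (1 - \<nu> * r / 16) * lyapunov k"
proof -
  have "\<nu> * r / 8 * lyapunov (Suc k) \<le> \<nu> * r / 8 * (4 * energy (Suc k))"
    using lyapunov_le_energy \<nu>_pos r_pos by (intro mult_left_mono) auto
  then have "lyapunov (Suc k) \<le> lyapunov k - \<nu> * r / 8 * lyapunov (Suc k)"
    using lyapunov_decrease[of k] by simp
  moreover have "0 \<le> lyapunov k"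
    using gap_nonneg[of k] gap_le_lyapunov[of k] by linarith
  ultimately have "lyapunov (Suc k) \<le> (1 - \<nu> * r / 8 / 2) * lyapunov k"
    using \<nu>_pos r_pos \<nu>_r_le by (intro relative_decrease_imp_contraction) auto
  then show ?thesis
    by simp
qed

lemma energy_0_le: "energy 0 \<le> (L + \<mu>) / 2 * (norm (x 0 - xs))\<^sup>2"
  using smooth_upper_bound[OF _ x_mem, of xs 0] gradient_at_minimizer[OF minimizer] minimizer
  by (simp add: energy_def gap_def z_0 is_arg_min_linorder algebra_simps)

lemma gap_linear_rate:
  "gap k \<le> 4 * (L + \<mu>) * (norm (x 0 - xs))\<^sup>2 * (1 - \<nu> * r / 16) ^ k"
proof -
  have rate_nonneg: "0 \<le> 1 - \<nu> * r / 16"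
    using \<nu>_r_le by simp
  have "lyapunov k \<le> (1 - \<nu> * r / 16) ^ k * lyapunov 0"
  proof (induction k)
    case (Suc k)
    have "lyapunov (Suc k) \<le> (1 - \<nu> * r / 16) * lyapunov k"
      by (rule lyapunov_contraction)
    also have "\<dots> \<le> (1 - \<nu> * r / 16) * ((1 - \<nu> * r / 16) ^ k * lyapunov 0)"
      using Suc rate_nonneg by (rule mult_left_mono)
    finally show ?case
      by (simp add: mult.assoc)
  qed simp
  also have "\<dots> \<le> (1 - \<nu> * r / 16) ^ k * (2 * (L + \<mu>) * (norm (x 0 - xs))\<^sup>2)"
    using lyapunov_le_energy[of 0] energy_0_le rate_nonneg
    by (intro mult_left_mono) (auto simp: algebra_simps)
  finally show ?thesis
    using gap_le_lyapunov[of k] by (simp add: algebra_simps)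
qed

end

section \<open>Parameters for small step sizes\<close>

text \<open>
  Solving \<open>x = c z + (1 - c) y\<close> with \<open>c = \<tau>r/(1 + r)\<close> for \<open>x - y\<close> gives \<open>c/(1 - c) (z - x)\<close>.
\<close>

definition coupling :: "real \<Rightarrow> real \<Rightarrow> real" where
  "coupling \<tau> r = \<tau> * r / (1 + r - \<tau> * r)"

lemma has_fps_expansion_imp_value_0:
  assumes "f has_fps_expansion F"
  shows "f 0 = fps_nth F 0"
proof -
  have "\<forall>\<^sub>F z in nhds 0. eval_fps F z = f z"
    using assms by (simp add: has_fps_expansion_def)
  then have "eval_fps F 0 = f 0"
    by (rule eventually_nhds_x_imp_x)
  then show ?thesis
    by (simp add: eval_fps_at_0)
qed

lemma has_fps_expansion_imp_field_differentiable:
  fixes F :: "'a::{banach, real_normed_field} fps"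
  assumes "f has_fps_expansion F"
  shows "f field_differentiable (at 0)"
proof -
  have "0 < fps_conv_radius F" and ev: "\<forall>\<^sub>F z in nhds 0. eval_fps F z = f z"
    using assms by (auto simp: has_fps_expansion_def)
  then have "(eval_fps F has_field_derivative eval_fps (fps_deriv F) 0) (at 0)"
    by (intro has_field_derivative_eval_fps) (auto simp: zero_ereal_def[symmetric])
  then show ?thesis
    using DERIV_cong_ev[OF refl ev refl] by (auto simp: field_differentiable_def)
qed

lemma field_differentiable_imp_tendsto:
  assumes "f field_differentiable (at a)"
  shows "(f \<longlongrightarrow> f a) (at a within S)"
  using field_differentiable_imp_continuous_at[OF field_differentiable_at_within[OF assms]]
  by (simp add: continuous_within)

lemma field_differentiable_imp_bigo:
  fixes f :: "'a::real_normed_field \<Rightarrow> 'a"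
  assumes "f field_differentiable (at a within S)"
  shows "(\<lambda>x. f x - f a) \<in> O[at a within S](\<lambda>x. x - a)"
proof -
  obtain D where "((\<lambda>x. (f x - f a) / (x - a)) \<longlongrightarrow> D) (at a within S)"
    using assms by (auto simp: field_differentiable_def has_field_derivative_iff)
  then show ?thesis
    by (rule bigoI_tendsto) (simp add: eventually_at_filter)
qed

lemma coupling_error_bigo:
  fixes v t :: "real \<Rightarrow> real"
  assumes "v field_differentiable (at 0)" "t field_differentiable (at 0)" "v 0 = t 0"
  shows "(\<lambda>r. coupling (t r) r - v r * r + (v r * r)\<^sup>2) \<in> O[at_right 0](\<lambda>r. r\<^sup>2)"
proof -
  define \<phi> where "\<phi> r = t r / (1 + r - t r * r) - v r + (v r)\<^sup>2 * r" for r
  have "\<phi> field_differentiable (at_right 0)"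
    unfolding \<phi>_def power2_eq_square
    by (intro derivative_intros field_differentiable_at_within[OF assms(1)]
        field_differentiable_at_within[OF assms(2)]) simp
  moreover have "\<phi> 0 = 0"
    using assms(3) by (simp add: \<phi>_def)
  ultimately have "\<phi> \<in> O[at_right 0](\<lambda>r. r)"
    using field_differentiable_imp_bigo[of \<phi> 0 "{0<..}"] by simp
  then have "(\<lambda>r. \<phi> r * r) \<in> O[at_right 0](\<lambda>r. r * r)"
    by (intro landau_o.big.mult_right)
  then show ?thesis
    by (simp add: \<phi>_def coupling_def algebra_simps power2_eq_square)
qed

lemma gradient_excess_linear_bound:
  fixes e v :: "real \<Rightarrow> real"
  assumes "e field_differentiable (at 0)" "v field_differentiable (at 0)" "(v 0)\<^sup>2 / 2 \<le> e 0"
  obtains K where "0 < K" "\<forall>\<^sub>F r in at_right 0. (v r)\<^sup>2 / 2 - e r \<le> K * r"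
proof -
  define \<psi> where "\<psi> r = (v r)\<^sup>2 / 2 - e r" for r
  have "\<psi> field_differentiable (at_right 0)"
    unfolding \<psi>_def power2_eq_square
    by (intro derivative_intros field_differentiable_at_within[OF assms(1)]
        field_differentiable_at_within[OF assms(2)]) simp
  then obtain K where "0 < K" "\<forall>\<^sub>F r in at_right 0. norm (\<psi> r - \<psi> 0) \<le> K * norm (r - 0)"
    by (rule landau_o.bigE[OF field_differentiable_imp_bigo])
  moreover from this(2) have "\<forall>\<^sub>F r in at_right 0. \<psi> r \<le> K * r"
    using eventually_at_right_less[of 0]
  proof eventually_elim
    case (elim r)
    moreover have "\<psi> 0 \<le> 0"
      using assms(3) by (simp add: \<psi>_def)
    ultimately show ?case
      by simp
  qed
  ultimately show ?thesis
    using that unfolding \<psi>_def by blast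
qed

lemma eventually_parameter_errors_le:
  fixes e v t :: "real \<Rightarrow> real"
  assumes diff: "e field_differentiable (at 0)" "v field_differentiable (at 0)"
      "t field_differentiable (at 0)"
    and "v 0 = t 0" "(v 0)\<^sup>2 / 2 \<le> e 0"
  obtains K where "0 < K" "\<forall>\<^sub>F r in at_right 0.
    \<bar>coupling (t r) r - v r * r + (v r * r)\<^sup>2\<bar> \<le> K * r\<^sup>2 \<and> (v r)\<^sup>2 / 2 - e r \<le> K * r"
proof -
  obtain A where "0 < A" and coupling:
    "\<forall>\<^sub>F r in at_right 0. norm (coupling (t r) r - v r * r + (v r * r)\<^sup>2) \<le> A * norm (r\<^sup>2)"
    using coupling_error_bigo[OF diff(2,3) assms(4)] by (elim landau_o.bigE) blast
  obtain B where excess: "\<forall>\<^sub>F r in at_right 0. (v r)\<^sup>2 / 2 - e r \<le> B * r"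
    using gradient_excess_linear_bound[OF diff(1,2) assms(5)] by blast
  have "\<forall>\<^sub>F r in at_right 0. \<bar>coupling (t r) r - v r * r + (v r * r)\<^sup>2\<bar> \<le> max A B * r\<^sup>2 \<and>
      (v r)\<^sup>2 / 2 - e r \<le> max A B * r"
    using coupling excess eventually_at_right_less[of 0]
  proof eventually_elim
    case (elim r)
    have "A * r\<^sup>2 \<le> max A B * r\<^sup>2" "B * r \<le> max A B * r"
      using \<open>0 < r\<close> by (intro mult_right_mono; simp)+
    with elim show ?case
      unfolding real_norm_def abs_power2 by (intro conjI) (erule order_trans, assumption)+
  qed
  then show ?thesis
    using \<open>0 < A\<close> by (intro that[of "max A B"]) auto
qed

lemma eventually_at_right_0_mult_less:
  fixes a b :: real
  assumes "0 < b"
  shows "\<forall>\<^sub>F h in at_right 0. a * h < b"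
proof (rule order_tendstoD(2)[OF _ assms])
  show "((\<lambda>h. a * h) \<longlongrightarrow> 0) (at_right 0)"
    by (auto intro!: tendsto_eq_intros)
qed

lemma admissible_parameters_of_bounds:
  assumes \<nu>: "0 < N" "N / 2 \<le> \<nu>" "\<nu> \<le> 2 * N" and \<eta>: "0 \<le> \<eta>" "\<eta> \<le> M"
    and r: "0 \<le> r" "2 * N * r \<le> 1 / 2" and h: "0 \<le> h" "h \<le> H" and "0 \<le> K"
    and errors: "\<bar>\<rho> - \<nu> * r + (\<nu> * r)\<^sup>2\<bar> \<le> K * r\<^sup>2" "\<nu>\<^sup>2 / 2 - \<eta> \<le> K * r"
    and H: "M * H \<le> 1 / 2" "2 * (2 * N)\<^sup>2 * H \<le> 1" "4 * K * (K + 2 * N) * H \<le> (N / 2)\<^sup>2"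
  shows "admissible_parameters \<eta> \<nu> \<rho> r h"
proof -
  have "\<nu> * r \<le> 2 * N * r"
    using \<nu>(3) r(1) by (rule mult_right_mono)
  then have "\<nu> * r \<le> 1 / 2"
    using r(2) by linarith
  moreover have "\<eta> * h \<le> M * H"
    using \<eta> h by (intro mult_mono) auto
  then have "\<eta> * h \<le> 1 / 2"
    using H(1) by linarith
  moreover have "2 * \<nu>\<^sup>2 * h \<le> 2 * (2 * N)\<^sup>2 * H"
    using \<nu> h by (intro mult_mono power_mono) auto
  then have "2 * \<nu>\<^sup>2 * h \<le> 1"
    using H(2) by linarith
  moreover have "4 * K * (K + \<nu>) * h \<le> 4 * K * (K + 2 * N) * H" "(N / 2)\<^sup>2 \<le> \<nu>\<^sup>2"
    using \<nu> h \<open>0 \<le> K\<close> by (auto intro!: mult_mono power_mono)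
  then have "4 * K * (K + \<nu>) * h \<le> \<nu>\<^sup>2"
    using H(3) by linarith
  ultimately show ?thesis
    unfolding admissible_parameters_def using \<nu> \<eta>(1) errors \<open>0 \<le> K\<close> by auto
qed

lemma eventually_admissible_parameters:
  fixes e v t :: "real \<Rightarrow> real"
  assumes diff: "e field_differentiable (at 0)" "v field_differentiable (at 0)"
      "t field_differentiable (at 0)"
    and v0: "0 < v 0" "v 0 = t 0" and e0: "(v 0)\<^sup>2 / 2 \<le> e 0"
  obtains H where "0 < H" "\<forall>\<^sub>F r in at_right 0. \<forall>h. 0 \<le> h \<and> h \<le> H \<longrightarrow>
    admissible_parameters (e r) (v r) (coupling (t r) r) r h"
proof -
  obtain K where "0 < K" and errors: "\<forall>\<^sub>F r in at_right 0.
      \<bar>coupling (t r) r - v r * r + (v r * r)\<^sup>2\<bar> \<le> K * r\<^sup>2 \<and> (v r)\<^sup>2 / 2 - e r \<le> K * r"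
    by (rule eventually_parameter_errors_le[OF diff v0(2) e0])
  have "0 < e 0"
    using e0 v0(1) by (meson half_gt_zero less_le_trans zero_less_power)
  have "\<forall>\<^sub>F H in at_right 0. 0 < H \<and> (e 0 + 1) * H < 1 / 2 \<and> 2 * (2 * v 0)\<^sup>2 * H < 1 \<and>
      4 * K * (K + 2 * v 0) * H < (v 0 / 2)\<^sup>2"
    using v0(1) by (intro eventually_conj eventually_at_right_less eventually_at_right_0_mult_less)
      auto
  then obtain H where "0 < H" and H: "(e 0 + 1) * H < 1 / 2" "2 * (2 * v 0)\<^sup>2 * H < 1"
      "4 * K * (K + 2 * v 0) * H < (v 0 / 2)\<^sup>2"
    using eventually_happens'[OF trivial_limit_at_right_real] by blast
  have "(e \<longlongrightarrow> e 0) (at_right 0)" "(v \<longlongrightarrow> v 0) (at_right 0)"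
    using diff(1,2)[THEN field_differentiable_imp_tendsto] by auto
  then have "\<forall>\<^sub>F r in at_right 0. v 0 / 2 < v r" "\<forall>\<^sub>F r in at_right 0. v r < 2 * v 0"
    "\<forall>\<^sub>F r in at_right 0. 0 < e r" "\<forall>\<^sub>F r in at_right 0. e r < e 0 + 1"
    using v0(1) \<open>0 < e 0\<close> by (auto elim!: order_tendstoD
        simp del: less_divide_eq_numeral1 divide_less_eq_numeral1)
  moreover have "\<forall>\<^sub>F r in at_right 0. 2 * v 0 * r < 1 / 2"
    by (rule eventually_at_right_0_mult_less) simp
  ultimately have "\<forall>\<^sub>F r in at_right 0. \<forall>h. 0 \<le> h \<and> h \<le> H \<longrightarrow>
    admissible_parameters (e r) (v r) (coupling (t r) r) r h"
    using errors eventually_at_right_less[of 0]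
  proof eventually_elim
    case (elim r)
    then show ?case
      using v0(1) H \<open>0 < K\<close>
      by (auto intro!: admissible_parameters_of_bounds[of "v 0" _ _ "e 0 + 1" _ _ H K])
  qed
  with \<open>0 < H\<close> show ?thesis
    by (rule that)
qed

section \<open>Algorithm A\<close>

lemma smooth_strongly_convex_on_Rn:
  assumes f: "f \<in> smooth_strongly_convex n \<mu> L" and "0 < \<mu>" "0 < L"
  shows "smooth_strongly_convex_on (Rn n) f (grad n f) L \<mu>"
proof
  have diff: "f differentiable_on Rn n"
    and lipschitz: "\<And>u w. u \<in> Rn n \<Longrightarrow> w \<in> Rn n \<Longrightarrow> norm (grad n f w - grad n f u) \<le> L * norm (w - u)"
    and strong: "\<And>u w. u \<in> Rn n \<Longrightarrow> w \<in> Rn n \<Longrightarrow>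
        f u + inner (grad n f u) (w - u) + \<mu> / 2 * (norm (w - u))\<^sup>2 \<le> f w"
    using f unfolding smooth_strongly_convex_def by auto
  show "subspace (Rn n)"
    by (rule subspace_Rn)
  show "L-lipschitz_on (Rn n) (grad n f)"
    using lipschitz \<open>0 < L\<close> by (auto simp: lipschitz_on_def dist_norm)
  fix u w assume u: "u \<in> Rn n"
  show "grad n f u \<in> Rn n" "(f has_derivative (\<lambda>h. inner (grad n f u) h)) (at u within Rn n)"
    using grad_has_derivative[OF diff u] by auto
  assume w: "w \<in> Rn n"
  show "f u + inner (grad n f u) (w - u) + \<mu> / 2 * (norm (w - u))\<^sup>2 \<le> f w"
    by (rule strong[OF u w])
  moreover have "0 \<le> \<mu> / 2 * (norm (w - u))\<^sup>2"
    using \<open>0 < \<mu>\<close> by simp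
  ultimately show "f u + inner (grad n f u) (w - u) \<le> f w"
    by linarith
qed (use assms in auto)

lemma algorithm_A_in_subspace:
  assumes "algorithm_A G \<mu> s \<eta> \<nu> \<tau> x0 x y z" "subspace S" "\<And>u. u \<in> S \<Longrightarrow> G u \<in> S" "x0 \<in> S"
  shows "x k \<in> S \<and> z k \<in> S"
proof (induction k)
  case 0
  then show ?case
    using assms by (simp add: algorithm_A_def Let_def)
next
  case (Suc k)
  with assms show ?case
    by (simp add: algorithm_A_def Let_def subspace_add subspace_diff subspace_scale)
qed

lemma algorithm_A_displacement:
  assumes alg: "algorithm_A G \<mu> s \<eta> \<nu> \<tau> x0 x y z" and r: "r = sqrt (\<mu> * s)" "0 \<le> r"
    and \<tau>: "\<tau> * r < 1 + r"
  shows "x (Suc k) - x k = coupling \<tau> r *\<^sub>R (z (Suc k) - x (Suc k)) - (\<eta> * s) *\<^sub>R G (x k)"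
proof -
  define c where "c = \<tau> * r / (1 + r)"
  have y: "y (Suc k) = x k - (\<eta> * s) *\<^sub>R G (x k)"
    and x: "x (Suc k) = c *\<^sub>R z (Suc k) + (1 - c) *\<^sub>R y (Suc k)"
    using alg r(1) by (auto simp: algorithm_A_def Let_def c_def)
  have "1 - c = (1 + r - \<tau> * r) / (1 + r)"
    using r(2) by (simp add: c_def field_simps)
  then have c: "coupling \<tau> r * (1 - c) = c"
    using \<tau> by (simp add: coupling_def c_def)
  have "z (Suc k) - x (Suc k) = (1 - c) *\<^sub>R (z (Suc k) - y (Suc k))"
    unfolding x by (simp add: algebra_simps)
  then have "coupling \<tau> r *\<^sub>R (z (Suc k) - x (Suc k)) = c *\<^sub>R (z (Suc k) - y (Suc k))"
    by (simp add: c)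
  also have "\<dots> = x (Suc k) - y (Suc k)"
    unfolding x by (simp add: algebra_simps)
  finally show ?thesis
    by (simp add: y)
qed

lemma algorithm_A_linear_rate:
  assumes \<mu>: "0 < \<mu>" "\<mu> \<le> L" and f: "f \<in> smooth_strongly_convex n \<mu> L"
    and min: "is_arg_min f (\<lambda>u. u \<in> Rn n) xs" and x0: "x0 \<in> Rn n" and s: "0 < s"
    and alg: "algorithm_A (grad n f) \<mu> s \<eta> \<nu> \<tau> x0 x y z"
    and r: "r = sqrt (\<mu> * s)"
    and \<tau>: "\<tau> * r < 1 + r"
    and admissible: "admissible_parameters \<eta> \<nu> (coupling \<tau> r) r (L * s)"
  shows "f (x k) - f xs \<le> 8 * L * (norm (x0 - xs))\<^sup>2 * (1 - \<nu> * r / 16) ^ k"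
proof -
  interpret smooth_strongly_convex_on "Rn n" f "grad n f" L \<mu>
    using f \<mu> by (intro smooth_strongly_convex_on_Rn) auto
  interpret accelerated_iteration "Rn n" f "grad n f" L \<mu> xs x z s r \<eta> \<nu> "coupling \<tau> r"
  proof
    show "x k \<in> Rn n" for k
      using algorithm_A_in_subspace[OF alg subspace G_mem x0] by blast
    show "z 0 = x 0"
      using alg by (simp add: algorithm_A_def Let_def)
    show "z (Suc k) = (\<nu> * r) *\<^sub>R (x k - (1 / \<mu>) *\<^sub>R grad n f (x k)) + (1 - \<nu> * r) *\<^sub>R z k" for k
      using alg by (simp add: algorithm_A_def Let_def r)
    show "x (Suc k) - x k = coupling \<tau> r *\<^sub>R (z (Suc k) - x (Suc k)) - (\<eta> * s) *\<^sub>R grad n f (x k)"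
      for k
      using alg r _ \<tau> by (rule algorithm_A_displacement) (use \<mu> s r in simp)
  qed (use \<mu> s r min admissible in auto)
  have "x 0 = x0"
    using alg by (simp add: algorithm_A_def Let_def)
  then have "f (x k) - f xs \<le> 4 * (L + \<mu>) * (norm (x0 - xs))\<^sup>2 * (1 - \<nu> * r / 16) ^ k"
    using gap_linear_rate[of k] by (simp add: gap_def)
  also have "\<dots> \<le> 8 * L * (norm (x0 - xs))\<^sup>2 * (1 - \<nu> * r / 16) ^ k"
    using \<mu> \<nu>_r_le by (intro mult_right_mono) auto
  finally show ?thesis .
qed

lemma linear_rate_of_admissible_parameters:
  assumes "0 < \<delta>"
    and parameters: "\<And>r h. 0 < r \<Longrightarrow> r < \<delta> \<Longrightarrow> 0 \<le> h \<Longrightarrow> h \<le> H \<Longrightarrow>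
      N \<le> v r \<and> t r * r < 1 + r \<and> admissible_parameters (e r) (v r) (coupling (t r) r) r h"
  shows "linear_rate e v t (\<lambda>\<mu> L. min H ((\<delta> / 2)\<^sup>2) / L) 8 (N / 16)"
  unfolding linear_rate_def
proof (intro allI impI, elim conjE)
  fix n \<mu> L f xs x0 s x y z and k :: nat
  define r where "r = sqrt (\<mu> * s)"
  assume \<mu>: "0 < \<mu>" "\<mu> \<le> L" and f: "f \<in> smooth_strongly_convex n \<mu> L"
    and min: "is_arg_min f (\<lambda>u. u \<in> Rn n) xs" and x0: "x0 \<in> Rn n"
    and s: "0 < s" "s \<le> min H ((\<delta> / 2)\<^sup>2) / L"
    and alg: "algorithm_A (grad n f) \<mu> s (e (sqrt (\<mu> * s))) (v (sqrt (\<mu> * s))) (t (sqrt (\<mu> * s)))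
      x0 x y z"
  have Ls: "0 \<le> L * s" "L * s \<le> H" "L * s \<le> (\<delta> / 2)\<^sup>2"
    using s \<mu> by (simp_all add: field_simps)
  have "\<mu> * s \<le> L * s"
    using \<mu> s by simp
  also note Ls(3)
  finally have "r \<le> \<delta> / 2"
    unfolding r_def using \<open>0 < \<delta>\<close> by (intro real_le_lsqrt) auto
  then have r: "0 < r" "r < \<delta>"
    using \<mu> s \<open>0 < \<delta>\<close> by (auto simp: r_def)
  have "N \<le> v r" and "t r * r < 1 + r"
    and admissible: "admissible_parameters (e r) (v r) (coupling (t r) r) r (L * s)"
    using parameters[OF r Ls(1,2)] by auto
  have "f (x k) - f xs \<le> 8 * L * (norm (x0 - xs))\<^sup>2 * (1 - v r * r / 16) ^ k"
    using \<mu> f min x0 s(1) alg[folded r_def] r_def \<open>t r * r < 1 + r\<close> admissible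
    by (rule algorithm_A_linear_rate)
  also have "\<dots> \<le> 8 * L * (norm (x0 - xs))\<^sup>2 * (1 - N / 16 * r) ^ k"
  proof (intro mult_left_mono power_mono)
    show "1 - v r * r / 16 \<le> 1 - N / 16 * r"
      using mult_right_mono[OF \<open>N \<le> v r\<close>, of r] r by simp
    show "0 \<le> 1 - v r * r / 16"
      using admissible by (simp add: admissible_parameters_def)
  qed (use \<mu> in auto)
  finally show "f (x k) - f xs \<le> 8 * L * (norm (x0 - xs))\<^sup>2 * (1 - N / 16 * sqrt (\<mu> * s)) ^ k"
    unfolding r_def .
qed

lemma linear_rate_small_step:
  fixes e v t :: "real \<Rightarrow> real"
  assumes diff: "e field_differentiable (at 0)" "v field_differentiable (at 0)"
      "t field_differentiable (at 0)"
    and v0: "0 < v 0" "v 0 = t 0" and e0: "(v 0)\<^sup>2 / 2 \<le> e 0"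
  obtains C0 where "0 < C0" "linear_rate e v t (\<lambda>\<mu> L. C0 / L) 8 (v 0 / 32)"
proof -
  obtain H where "0 < H" and admissible: "\<forall>\<^sub>F r in at_right 0. \<forall>h. 0 \<le> h \<and> h \<le> H \<longrightarrow>
      admissible_parameters (e r) (v r) (coupling (t r) r) r h"
    by (rule eventually_admissible_parameters[OF assms])
  have v_lim: "(v \<longlongrightarrow> v 0) (at_right 0)" and t_lim: "(t \<longlongrightarrow> t 0) (at_right 0)"
    using diff(2,3)[THEN field_differentiable_imp_tendsto] by auto
  have "\<forall>\<^sub>F r in at_right 0. v 0 / 2 < v r"
    using v0(1) by (intro order_tendstoD[OF v_lim]) simp
  moreover have "\<forall>\<^sub>F r in at_right 0. 0 < 1 + r - t r * r"
    by (rule order_tendstoD(1)[of _ 1]) (auto intro!: tendsto_eq_intros t_lim)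
  ultimately have "\<forall>\<^sub>F r in at_right 0. v 0 / 2 \<le> v r \<and> t r * r < 1 + r \<and>
      (\<forall>h. 0 \<le> h \<and> h \<le> H \<longrightarrow> admissible_parameters (e r) (v r) (coupling (t r) r) r h)"
    using admissible by eventually_elim auto
  then obtain \<delta> where "0 < \<delta>" and "\<forall>r>0. r < \<delta> \<longrightarrow> v 0 / 2 \<le> v r \<and> t r * r < 1 + r \<and>
      (\<forall>h. 0 \<le> h \<and> h \<le> H \<longrightarrow> admissible_parameters (e r) (v r) (coupling (t r) r) r h)"
    unfolding eventually_at_right_field by blast
  then have "linear_rate e v t (\<lambda>\<mu> L. min H ((\<delta> / 2)\<^sup>2) / L) 8 (v 0 / 2 / 16)"
    by (intro linear_rate_of_admissible_parameters) auto
  then show ?thesis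
    using \<open>0 < H\<close> \<open>0 < \<delta>\<close> by (intro that[of "min H ((\<delta> / 2)\<^sup>2)"]) auto
qed

lemma linear_rate_mono:
  assumes "linear_rate e v t smax C C1"
    and "\<And>\<mu> L. 0 < \<mu> \<Longrightarrow> \<mu> \<le> L \<Longrightarrow> smax' \<mu> L \<le> smax \<mu> L"
  shows "linear_rate e v t smax' C C1"
  unfolding linear_rate_def
proof (intro allI impI, elim conjE)
  fix n \<mu> L f xs x0 s x y z and k :: nat
  assume *: "0 < \<mu>" "\<mu> \<le> L" "f \<in> smooth_strongly_convex n \<mu> L"
    "is_arg_min f (\<lambda>u. u \<in> Rn n) xs" "x0 \<in> Rn n" "0 < s"
    "algorithm_A (grad n f) \<mu> s (e (sqrt (\<mu> * s))) (v (sqrt (\<mu> * s))) (t (sqrt (\<mu> * s))) x0 x y z"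
    "1 \<le> k" and "s \<le> smax' \<mu> L"
  then have "s \<le> smax \<mu> L"
    using assms(2)[of \<mu> L] by linarith
  with * show "f (x k) - f xs \<le> C * L * (norm (x0 - xs))\<^sup>2 * (1 - C1 * sqrt (\<mu> * s)) ^ k"
    using assms(1) unfolding linear_rate_def by blast
qed

theorem theorem3:
  fixes e v t :: "real \<Rightarrow> real" and \<eta> \<nu> \<tau> :: "nat \<Rightarrow> real"
  assumes "\<forall>\<^sub>F r in nhds 0. 0 \<le> e r" "\<forall>\<^sub>F r in nhds 0. 0 \<le> v r" "\<forall>\<^sub>F r in nhds 0. 0 \<le> t r"
    and "e has_fps_expansion Abs_fps \<eta>" "v has_fps_expansion Abs_fps \<nu>" "t has_fps_expansion Abs_fps \<tau>"
    and "0 < \<nu> 0" "\<nu> 0 = \<tau> 0" "\<eta> 0 \<ge> (\<tau> 0)\<^sup>2 / 2"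
  shows
    "(\<eta> 0 = (\<tau> 0)\<^sup>2 / 2 \<and>
      \<nu> 1 - \<tau> 1 < \<tau> 0 * (\<tau> 0 / 2 - 1) \<and>
      2 * \<eta> 1 < \<nu> 1 * \<tau> 1 + (\<tau> 0)\<^sup>2 / 2 * (5 / 2 * \<tau> 0 - 2)
      \<longrightarrow> (\<exists>C>0. \<exists>C0>0. \<exists>C1>0. linear_rate e v t (\<lambda>\<mu> L. C0 * \<mu> / L\<^sup>2) C C1))
   \<and> ((\<eta> 0 = (\<tau> 0)\<^sup>2 / 2 \<and>
       \<nu> 1 - \<tau> 1 < \<tau> 0 * (\<tau> 0 / 2 - 1) \<and>
       2 * \<eta> 1 \<ge> \<nu> 1 * \<tau> 1 + (\<tau> 0)\<^sup>2 / 2 * (5 / 2 * \<tau> 0 - 2)) \<or>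
      (\<eta> 0 > (\<tau> 0)\<^sup>2 / 2 \<and>
       \<nu> 1 - \<tau> 1 < (\<tau> 0 - 1) * \<tau> 0 - \<eta> 0) \<or>
      (\<eta> 0 > (\<tau> 0)\<^sup>2 / 2 \<and>
       (\<tau> 0 - 1) * \<tau> 0 - \<eta> 0 < \<nu> 1 - \<tau> 1 \<and>
       \<nu> 1 - \<tau> 1 < \<eta> 0 - \<tau> 0)
      \<longrightarrow> (\<exists>C>0. \<exists>C0>0. \<exists>C1>0. linear_rate e v t (\<lambda>\<mu> L. C0 / L) C C1))"
proof -
  have "v 0 = \<nu> 0" "t 0 = \<tau> 0" "e 0 = \<eta> 0"
    using assms(4-6)[THEN has_fps_expansion_imp_value_0] by simp_all
  then have "0 < v 0" "v 0 = t 0" "(v 0)\<^sup>2 / 2 \<le> e 0"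
    using assms by simp_all
  then obtain C0 where "0 < C0" and rate: "linear_rate e v t (\<lambda>\<mu> L. C0 / L) 8 (v 0 / 32)"
    using linear_rate_small_step
      assms(4-6)[THEN has_fps_expansion_imp_field_differentiable] by metis
  have "linear_rate e v t (\<lambda>\<mu> L. C0 * \<mu> / L\<^sup>2) 8 (v 0 / 32)"
    using rate by (rule linear_rate_mono) (use \<open>0 < C0\<close> in \<open>simp add: field_simps power2_eq_square\<close>)
  moreover have "(8::real) > 0" "v 0 / 32 > 0"
    using \<open>0 < v 0\<close> by simp_all
  ultimately show ?thesis
    using rate \<open>0 < C0\<close> by blast
qed

end
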